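(* Let $q=2^m$ with $m$ a positive integer, let $f\in\mathbb{F}_q[x]$ be an o-polynomial, let $v\in\mathbb{F}_q\setminus\{f(x)+x : x\in\mathbb{F}_q\}$, and write $\mathbb{F}_q=\{\alpha_1,\ldots,\alpha_{q-1},\alpha_q\}$ with $\alpha_q=0$. Let $\mathcal{C}_v$ be the linear code over $\mathbb{F}_q$ with generator matrix $$G_v=\begin{pmatrix} f(\alpha_1) & f(\alpha_2) & \cdots & f(\alpha_{q-1}) & f(\alpha_q) & 1 & 0 & 1 & 0 & v\\ \alpha_1 & \alpha_2 & \cdots & \alpha_{q-1} & \alpha_q & 0 & 1 & 1 & v & 0\\ 1 & 1 & \cdots & 1 & 1 & 0 & 0 & 0 & 1 & 1\end{pmatrix}.$$ Then $\mathcal{C}_v$ is a $[q+5,3,q+2]$ NMDS code over $\mathbb{F}_q$ with weight enumerator $$A(z)=1+\frac{(q-1)(3q+8)}{2}z^{q+2}+\frac{(q-1)(q+2)(q-2)}{2}z^{q+3}+\frac{3(q-1)(q-2)}{2}z^{q+4}+\frac{(q-1)(q-2)^2}{2}z^{q+5}.$$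
   Context: An $[n,k,d]$ linear code over $\mathbb{F}_q$ is a $k$-dimensional subspace $\mathcal{C}$ of $\mathbb{F}_q^n$ with minimum nonzero Hamming weight $d$. Its dual $\mathcal{C}^\perp$ is taken with respect to the Euclidean inner product. The Singleton defect of an $[n,k,d]$ code is $s(\mathcal{C})=n-k+1-d$; $\mathcal{C}$ is near maximum distance separable (NMDS) if $s(\mathcal{C})=s(\mathcal{C}^\perp)=1$. The weight enumerator of $\mathcal{C}$ is $A(z)=1+A_1z+\cdots+A_nz^n$, where $A_i$ is the number of codewords of weight $i$. For $q$ a power of $2$, an o-polynomial (oval polynomial) over $\mathbb{F}_q$ is a permutation polynomial $f\in\mathbb{F}_q[x]$ of $\mathbb{F}_q$ such that (1) $\deg f<q$, $f(0)=0$, $f(1)=1$; and (2) for each $a\in\mathbb{F}_q$, $g_a(x):=(f(x+a)+f(a))x^{q-2}$ is also a permutation polynomial of $\mathbb{F}_q$. *)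

theory Defs
  imports
    "HOL-Library.Cardinality"
    "HOL-Computational_Algebra.Polynomial"
    "Jordan_Normal_Form.VS_Connect"
begin

text \<open>
  A code of length \<open>n\<close> over the finite field \<open>'a\<close> is a set of vectors of dimension \<open>n\<close>; the order
  of the field is \<open>CARD('a)\<close>.
\<close>

definition linear_code :: "nat \<Rightarrow> 'a::{field,finite} vec set \<Rightarrow> bool" where
  "linear_code n C \<longleftrightarrow> VectorSpace.subspace class_ring C (module_vec TYPE('a) n)"

definition code_dim :: "nat \<Rightarrow> 'a::{field,finite} vec set \<Rightarrow> nat" where
  "code_dim n C = vectorspace.dim class_ring ((module_vec TYPE('a) n)\<lparr>carrier := C\<rparr>)"

definition hamming_weight :: "'a::zero vec \<Rightarrow> nat" where
  "hamming_weight c = card {i. i < dim_vec c \<and> c $ i \<noteq> 0}"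

text \<open>Only meaningful for codes other than \<open>{0\<^sub>v n}\<close>, since \<open>Min {}\<close> is unspecified.\<close>

definition min_distance :: "nat \<Rightarrow> 'a::{field,finite} vec set \<Rightarrow> nat" where
  "min_distance n C = Min (hamming_weight ` (C - {0\<^sub>v n}))"

text \<open>\<open>nkd_code n k d C\<close>: \<open>C\<close> is an $[n,k,d]$ linear code.\<close>

definition nkd_code :: "nat \<Rightarrow> nat \<Rightarrow> nat \<Rightarrow> 'a::{field,finite} vec set \<Rightarrow> bool" where
  "nkd_code n k d C \<longleftrightarrow>
     linear_code n C \<and> C \<noteq> {0\<^sub>v n} \<and> code_dim n C = k \<and> min_distance n C = d"

definition dual_code :: "nat \<Rightarrow> 'a::{field,finite} vec set \<Rightarrow> 'a vec set" where
  "dual_code n C = {x \<in> carrier_vec n. \<forall>c\<in>C. x \<bullet> c = 0}"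

definition singleton_defect :: "nat \<Rightarrow> 'a::{field,finite} vec set \<Rightarrow> int" where
  "singleton_defect n C = int n - int (code_dim n C) + 1 - int (min_distance n C)"

text \<open>
  The non-triviality conditions ensure that both minimum distances, hence both Singleton defects,
  are defined.
\<close>

definition NMDS :: "nat \<Rightarrow> 'a::{field,finite} vec set \<Rightarrow> bool" where
  "NMDS n C \<longleftrightarrow>
     linear_code n C \<and> C \<noteq> {0\<^sub>v n} \<and> dual_code n C \<noteq> {0\<^sub>v n} \<and>
     singleton_defect n C = 1 \<and> singleton_defect n (dual_code n C) = 1"

definition weight_count :: "'a::{field,finite} vec set \<Rightarrow> nat \<Rightarrow> nat" where
  "weight_count C i = card {c \<in> C. hamming_weight c = i}"

definition weight_enumerator :: "nat \<Rightarrow> 'a::{field,finite} vec set \<Rightarrow> real poly" where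
  "weight_enumerator n C = 1 + (\<Sum>i=1..n. monom (real (weight_count C i)) i)"

definition code_generated_by :: "'a::{field,finite} mat \<Rightarrow> 'a vec set" where
  "code_generated_by G = vec_space.row_space (dim_col G) G"

definition permutation_polynomial :: "'a::{field,finite} poly \<Rightarrow> bool" where
  "permutation_polynomial f \<longleftrightarrow> bij (poly f)"

text \<open>
  Here \<open>pcompose f [:a, 1:]\<close> is $f(x+a)$. For \<open>CARD('a) = 2\<close> the factor $x^{q-2}$ is the constant
  polynomial $1$.
\<close>

definition o_polynomial :: "'a::{field,finite} poly \<Rightarrow> bool" where
  "o_polynomial f \<longleftrightarrow>
     permutation_polynomial f \<and>
     degree f < CARD('a) \<and> poly f 0 = 0 \<and> poly f 1 = 1 \<and>
     (\<forall>a. permutation_polynomial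
            ((pcompose f [:a, 1:] + [:poly f a:]) * monom 1 (CARD('a) - 2)))"

definition gen_matrix :: "nat \<Rightarrow> (nat \<Rightarrow> 'a::{field,finite}) \<Rightarrow> 'a poly \<Rightarrow> 'a \<Rightarrow> 'a mat" where
  "gen_matrix q \<alpha> f v = mat_of_rows_list (q + 5)
     [map (\<lambda>i. poly f (\<alpha> i)) [1..<q+1] @ [1, 0, 1, 0, v],
      map (\<lambda>i. \<alpha> i)          [1..<q+1] @ [0, 1, 1, v, 0],
      map (\<lambda>i. 1)            [1..<q+1] @ [0, 0, 0, 1, 1]]"

end

theory Submission
  imports Defs "Jordan_Normal_Form.Matrix_Kernel"
begin

text \<open>
  The columns of the generator matrix, read as points of the projective plane over the field, are
  the $q+2$ points $(f(x):x:1)$, $(1:0:0)$, $(0:1:0)$ and the three points $(1:1:0)$, $(0:v:1)$,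
  $(v:0:1)$. The first $q+2$ form a hyperoval, so every line meets them in $0$ or $2$ points. The
  last three lie on the line $X+Y=vZ$, which by the choice of $v$ misses the hyperoval; every other
  line contains at most one of them. The weight of the codeword of $u$ is $q+5$ minus the number of
  these points on the line $u$. The five possible incidence types are counted by summing over all
  lines the number of hyperoval points, the number of extra points and the product of the two.
  In the dual, words of weight at most $2$ are excluded since the points are distinct, and the
  collinear triple gives a word of weight $3$.
\<close>

section \<open>Codes as images and kernels of matrices\<close>

lemma linear_map_mult_mat_vec:
  fixes A :: "'a::field mat"
  assumes A: "A \<in> carrier_mat nr nc"
  shows "linear_map class_ring (module_vec TYPE('a) nc) (module_vec TYPE('a) nr) ((*\<^sub>v) A)"
proof -
  interpret V: vec_space "TYPE('a)" nc .
  interpret W: vec_space "TYPE('a)" nr .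
  show ?thesis
  proof unfold_locales
    show "(*\<^sub>v) A \<in> LinearCombinations.module_hom class_ring (module_vec TYPE('a) nc) (module_vec TYPE('a) nr)"
      using A by (auto simp: LinearCombinations.module_hom_def module_vec_def
          mult_add_distrib_mat_vec mult_mat_vec)
  qed
qed

text \<open>Both are read off the linear map given by the matrix. Rank-nullity, applied to the
  generator matrix, later yields the dimension of the dual code.\<close>

lemma
  fixes A :: "'a::{field,finite} mat"
  assumes A: "A \<in> carrier_mat nr nc"
  shows linear_code_image: "linear_code nr ((*\<^sub>v) A ` carrier_vec nc)"
    and rank_nullity_mat:
      "code_dim nr ((*\<^sub>v) A ` carrier_vec nc) + code_dim nc (mat_kernel A) = nc"
proof -
  interpret V: vec_space "TYPE('a)" nc .
  interpret W: vec_space "TYPE('a)" nr .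
  interpret L: linear_map class_ring "module_vec TYPE('a) nc" "module_vec TYPE('a) nr" "(*\<^sub>v) A"
    by (rule linear_map_mult_mat_vec[OF A])
  have im: "L.im = (*\<^sub>v) A ` carrier_vec nc"
    unfolding L.im_def by (simp add: module_vec_def)
  have ker: "L.ker = mat_kernel A"
    unfolding L.ker_def using A by (auto simp: mat_kernel_def module_vec_def)
  show "linear_code nr ((*\<^sub>v) A ` carrier_vec nc)"
    using L.imT_is_subspace by (simp add: linear_code_def im)
  show "code_dim nr ((*\<^sub>v) A ` carrier_vec nc) + code_dim nc (mat_kernel A) = nc"
    using L.rank_nullity[OF V.fin_dim] by (simp add: code_dim_def im ker V.dim_is_n)
qed

lemma code_dim_carrier_vec: "code_dim n (carrier_vec n :: 'a::{field,finite} vec set) = n"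
proof -
  interpret V: vec_space "TYPE('a)" n .
  show ?thesis
    using V.dim_is_n by (simp add: code_dim_def module_vec_def)
qed

lemma code_dim_image_of_inj:
  fixes A :: "'a::{field,finite} mat"
  assumes A: "A \<in> carrier_mat nr nc" and inj: "inj_on ((*\<^sub>v) A) (carrier_vec nc)"
  shows "code_dim nr ((*\<^sub>v) A ` carrier_vec nc) = nc"
proof -
  interpret V: vec_space "TYPE('a)" nc .
  interpret L: linear_map class_ring "module_vec TYPE('a) nc" "module_vec TYPE('a) nr" "(*\<^sub>v) A"
    by (rule linear_map_mult_mat_vec[OF A])
  have im: "L.im = (*\<^sub>v) A ` carrier_vec nc"
    unfolding L.im_def by (simp add: module_vec_def)
  have "inj_on ((*\<^sub>v) A) (carrier (module_vec TYPE('a) nc))"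
    using inj by (simp add: module_vec_def)
  then show ?thesis
    using L.rank_nullity[OF V.fin_dim] L.inj_imp_dim_ker0 by (simp add: code_dim_def im V.dim_is_n)
qed

lemma code_generated_by_eq:
  assumes "G \<in> carrier_mat k n"
  shows "code_generated_by G = (*\<^sub>v) G\<^sup>T ` carrier_vec k"
  using assms vec_space.row_space_eq[OF assms] by (auto simp: code_generated_by_def)

text \<open>Moving the transpose across the inner product turns orthogonality to the code into
  orthogonality of \<open>G *\<^sub>v x\<close> to every \<open>y\<close>; testing with unit vectors
  shows that \<open>G *\<^sub>v x\<close> vanishes.\<close>

lemma dual_code_generated_by:
  assumes G: "G \<in> carrier_mat k n"
  shows "dual_code n (code_generated_by G) = mat_kernel G"
proof -
  have *: "x \<bullet> (G\<^sup>T *\<^sub>v y) = y \<bullet> (G *\<^sub>v x)" if "x \<in> carrier_vec n" "y \<in> carrier_vec k" for x y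
    using transpose_vec_mult_scalar[OF G that] G that
    by (metis comm_scalar_prod mult_mat_vec_carrier transpose_carrier_mat)
  have "G *\<^sub>v x = 0\<^sub>v k \<longleftrightarrow> (\<forall>y\<in>carrier_vec k. y \<bullet> (G *\<^sub>v x) = 0)" if "x \<in> carrier_vec n" for x
  proof
    assume orth: "\<forall>y\<in>carrier_vec k. y \<bullet> (G *\<^sub>v x) = 0"
    show "G *\<^sub>v x = 0\<^sub>v k"
    proof (rule eq_vecI)
      fix i assume "i < dim_vec (0\<^sub>v k :: 'a vec)"
      then have i: "i < k"
        by simp
      then have "unit_vec k i \<bullet> (G *\<^sub>v x) = (G *\<^sub>v x) $ i"
        using G that by (intro scalar_prod_left_unit) auto
      with orth i show "(G *\<^sub>v x) $ i = 0\<^sub>v k $ i"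
        by simp
    qed (use G in simp)
  qed (use that in simp)
  then show ?thesis
    using G * by (auto simp: dual_code_def code_generated_by_eq[OF G] mat_kernel_def)
qed

section \<open>Finite fields, double counting and o-polynomials\<close>

lemma one_plus_one_eq_0_of_card_power_2:
  assumes "CARD('a::{field,finite}) = 2 ^ m"
  shows "(1::'a) + 1 = 0"
proof -
  \<comment> \<open>Translation by 1 permutes the field. Comparing the two sums shows that the field
    order is 0 in the field, and a field has no nilpotent element other than 0.\<close>
  have "(\<Sum>x\<in>UNIV. x + 1) = (\<Sum>x\<in>UNIV. x :: 'a)"
    by (rule sum.reindex_bij_witness[of _ "\<lambda>x. x - 1" "\<lambda>x. x + 1"]) auto
  then have "of_nat CARD('a) = (0::'a)"
    by (simp add: sum.distrib)
  then have "(2::'a) ^ m = 0"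
    using assms by simp
  then show ?thesis
    by simp
qed

lemma power_card_minus_one:
  fixes x :: "'a::{field,finite}"
  assumes "x \<noteq> 0"
  shows "x ^ (CARD('a) - 1) = 1"
proof -
  \<comment> \<open>Multiplication by \<open>x\<close> permutes the nonzero elements, whose product
    can be cancelled.\<close>
  have "\<Prod>(UNIV - {0::'a}) = (\<Prod>y\<in>UNIV - {0}. x * y)"
    by (rule prod.reindex_bij_witness[of _ "\<lambda>y. x * y" "\<lambda>y. y / x"]) (use assms in auto)
  also have "\<dots> = x ^ (CARD('a) - 1) * \<Prod>(UNIV - {0})"
    by (simp add: prod.distrib)
  finally show ?thesis
    by simp
qed

lemma sum_card_swap:
  assumes "finite A" "finite B"
  shows "(\<Sum>x\<in>A. card {y\<in>B. R x y}) = (\<Sum>y\<in>B. card {x\<in>A. R x y})"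
  using sum.swap_restrict[OF assms, of "\<lambda>_ _. 1 :: nat" R] by simp


text \<open>For \<open>t \<noteq> 0\<close> the factor \<open>t ^ (CARD('a) - 2)\<close> is the
  inverse of \<open>t\<close>, so the polynomial of the o-polynomial condition takes the slope of
  the chord from \<open>a\<close> to \<open>a + t\<close> as its value. Being a permutation that
  fixes 0, it takes each nonzero slope at exactly one nonzero \<open>t\<close>.\<close>

lemma o_polynomial_secant:
  fixes f :: "'a::{field,finite} poly"
  assumes f: "o_polynomial f" and char2: "(1::'a) + 1 = 0" and s: "s \<noteq> 0"
  shows "\<exists>!t. t \<noteq> 0 \<and> poly f (a + t) + poly f a = s * t"
proof -
  define g where "g = poly ((pcompose f [:a, 1:] + [:poly f a:]) * monom 1 (CARD('a) - 2))"
  have bij: "bij g"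
    using f by (simp add: o_polynomial_def permutation_polynomial_def g_def)
  have g: "g t = (poly f (a + t) + poly f a) * t ^ (CARD('a) - 2)" for t
    by (simp add: g_def poly_pcompose poly_monom)
  \<comment> \<open>The first factor vanishes at \<open>t = 0\<close>. This matters for a field of
    order 2, where the power of \<open>t\<close> is the constant 1.\<close>
  have "poly f a + poly f a = 0"
    using char2 by (metis mult_zero_right mult_2_right one_add_one)
  then have g0: "g 0 = 0"
    by (simp add: g)
  have card: "CARD('a) \<ge> 2"
    using card_mono[of UNIV "{0, 1::'a}"] by simp
  have "g t = s \<longleftrightarrow> poly f (a + t) + poly f a = s * t" if "t \<noteq> 0" for t
  proof -
    have "t ^ (CARD('a) - 2) * t = 1"
      using power_card_minus_one[OF that] card
      by (metis Suc_diff_Suc Suc_1 Suc_le_lessD power_Suc2)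
    then have "g t * t = poly f (a + t) + poly f a"
      by (simp add: g mult.assoc)
    then show ?thesis
      using that by auto
  qed
  moreover have "\<exists>!t. g t = s"
    using bij by (simp add: bij_iff)
  ultimately show ?thesis
    using g0 s by metis
qed

section \<open>Counting solutions of linear equations in three unknowns\<close>

fun dot3 :: "'a::comm_ring_1 \<times> 'a \<times> 'a \<Rightarrow> 'a \<times> 'a \<times> 'a \<Rightarrow> 'a" where
  "dot3 (a, b, c) (x, y, z) = a * x + b * y + c * z"

text \<open>The vector product, which vanishes exactly on linearly dependent pairs and so tells
  projective points apart.\<close>

fun cross3 :: "'a::comm_ring_1 \<times> 'a \<times> 'a \<Rightarrow> 'a \<times> 'a \<times> 'a \<Rightarrow> 'a \<times> 'a \<times> 'a" where
  "cross3 (a, b, c) (x, y, z) = (b * z - c * y, c * x - a * z, a * y - b * x)"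

text \<open>Solving for the coefficient of a nonzero coordinate of \<open>p\<close> presents the
  solution set as a graph over the other two coefficients.\<close>

lemma card_dot3_eq_0:
  fixes p :: "'a::{field,finite} \<times> 'a \<times> 'a"
  assumes "p \<noteq> (0, 0, 0)"
  shows "card {u. dot3 u p = 0} = CARD('a) ^ 2"
proof -
  obtain x y z where p: "p = (x, y, z)"
    by (cases p)
  have *: "card {u. dot3 u p = 0} = CARD('a) ^ 2" if "inj h" "{u. dot3 u p = 0} = range h"
    for h :: "'a \<times> 'a \<Rightarrow> 'a \<times> 'a \<times> 'a"
    using that by (simp add: card_image power2_eq_square)
  consider "x \<noteq> 0" | "y \<noteq> 0" | "z \<noteq> 0"
    using assms p by auto
  then show ?thesis
  proof cases
    case 1
    have "a * x + b * y + c * z = 0 \<longleftrightarrow> a = - (b * y + c * z) / x" for a b c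
      using 1 by (simp add: nonzero_eq_divide_eq eq_diff_eq eq_neg_iff_add_eq_0 add_ac)
    then show ?thesis
      by (intro *[of "\<lambda>(b, c). (- (b * y + c * z) / x, b, c)"]) (use 1 in \<open>auto simp: p inj_on_def image_iff\<close>)
  next
    case 2
    have "a * x + b * y + c * z = 0 \<longleftrightarrow> b = - (a * x + c * z) / y" for a b c
      using 2 by (simp add: nonzero_eq_divide_eq eq_diff_eq eq_neg_iff_add_eq_0 add_ac)
    then show ?thesis
      by (intro *[of "\<lambda>(a, c). (a, - (a * x + c * z) / y, c)"]) (use 2 in \<open>auto simp: p inj_on_def image_iff\<close>)
  next
    case 3
    have "a * x + b * y + c * z = 0 \<longleftrightarrow> c = - (a * x + b * y) / z" for a b c
      using 3 by (simp add: nonzero_eq_divide_eq eq_diff_eq eq_neg_iff_add_eq_0 add_ac)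
    then show ?thesis
      by (intro *[of "\<lambda>(a, b). (a, b, - (a * x + b * y) / z)"]) (use 3 in \<open>auto simp: p inj_on_def image_iff\<close>)
  qed
qed

text \<open>The common solutions are the scalar multiples of the nonzero triple
  \<open>cross3 p r\<close>.\<close>

lemma card_dot3_eq_0_pair:
  fixes p r :: "'a::{field,finite} \<times> 'a \<times> 'a"
  assumes "cross3 p r \<noteq> (0, 0, 0)"
  shows "card {u. dot3 u p = 0 \<and> dot3 u r = 0} = CARD('a)"
proof -
  obtain x y z x' y' z' where p: "p = (x, y, z)" and r: "r = (x', y', z')"
    by (cases p, cases r)
  obtain k l m where w: "cross3 p r = (k, l, m)"
    by (cases "cross3 p r")
  have klm: "k = y * z' - z * y'" "l = z * x' - x * z'" "m = x * y' - y * x'"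
    using w by (simp_all add: p r)
  have nz: "k \<noteq> 0 \<or> l \<noteq> 0 \<or> m \<noteq> 0"
    using assms w by auto
  define h where "h = (\<lambda>t. (t * k, t * l, t * m))"
  have "inj h"
    using nz by (auto simp: h_def inj_on_def)
  moreover have "{u. dot3 u p = 0 \<and> dot3 u r = 0} = range h"
  proof (intro equalityI subsetI)
    fix u assume u: "u \<in> {u. dot3 u p = 0 \<and> dot3 u r = 0}"
    obtain a b c where abc: "u = (a, b, c)"
      by (cases u)
    have 1: "a * x + b * y + c * z = 0" and 2: "a * x' + b * y' + c * z' = 0"
      using u by (simp_all add: abc p r)
    \<comment> \<open>This identity and the next two are, up to sign, the coordinates of the double
      vector product u x (p x r) = (u.r) p - (u.p) r. They say that \<open>u\<close> is proportional
      to \<open>cross3 p r\<close>.\<close>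
    have "a * l - b * k = z * (a * x' + b * y' + c * z') - z' * (a * x + b * y + c * z)"
      by (simp add: klm algebra_simps)
    then have al: "a * l = b * k"
      by (simp add: 1 2)
    have "a * m - c * k = y' * (a * x + b * y + c * z) - y * (a * x' + b * y' + c * z')"
      by (simp add: klm algebra_simps)
    then have am: "a * m = c * k"
      by (simp add: 1 2)
    have "b * m - c * l = x * (a * x' + b * y' + c * z') - x' * (a * x + b * y + c * z)"
      by (simp add: klm algebra_simps)
    then have bm: "b * m = c * l"
      by (simp add: 1 2)
    consider "k \<noteq> 0" | "l \<noteq> 0" | "m \<noteq> 0"
      using nz by blast
    then have "\<exists>t. a = t * k \<and> b = t * l \<and> c = t * m"
    proof cases
      case 1
      with al am show ?thesis
        by (intro exI[of _ "a / k"]) (simp add: field_simps)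
    next
      case 2
      with al bm show ?thesis
        by (intro exI[of _ "b / l"]) (simp add: field_simps)
    next
      case 3
      with am bm show ?thesis
        by (intro exI[of _ "c / m"]) (simp add: field_simps)
    qed
    then show "u \<in> range h"
      by (auto simp: abc h_def)
  next
    fix u assume "u \<in> range h"
    then show "u \<in> {u. dot3 u p = 0 \<and> dot3 u r = 0}"
      by (auto simp: h_def p r klm algebra_simps)
  qed
  ultimately show ?thesis
    by (simp add: card_image)
qed

section \<open>The hyperoval, the three extra points and their incidences with lines\<close>

locale extended_hyperoval =
  fixes f :: "'a::{field,finite} \<Rightarrow> 'a" and v :: 'a and q :: nat
  assumes card_field: "CARD('a) = q"
    and char2: "(1::'a) + 1 = 0"
    and f_bij: "bij f" and f_0: "f 0 = 0"
    and secant: "s \<noteq> 0 \<Longrightarrow> \<exists>!t. t \<noteq> 0 \<and> f (a + t) + f a = s * t"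
    and v: "f x + x \<noteq> v"
begin

text \<open>
  A triple stands for a vector representing a point of the projective plane, and a triple \<open>u\<close> in
  \<open>lines\<close> for the line of all \<open>p\<close> with \<open>dot3 u p = 0\<close>; each projective line occurs \<open>q - 1\<close> times.
\<close>

definition oval :: "('a \<times> 'a \<times> 'a) set" where "oval = insert (1, 0, 0) (insert (0, 1, 0) (range (\<lambda>x. (f x, x, 1))))"

definition ext :: "('a \<times> 'a \<times> 'a) set" where "ext = {(1, 1, 0), (0, v, 1), (v, 0, 1)}"

definition oval_mult where "oval_mult u = card {p\<in>oval. dot3 u p = 0}"

definition ext_mult where "ext_mult u = card {p\<in>ext. dot3 u p = 0}"

abbreviation lines where "lines \<equiv> UNIV - {(0::'a, 0::'a, 0::'a)}"

lemma add_self [simp]: "x + x = (0::'a)"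
  using char2 by (metis mult_zero_right mult_2_right one_add_one)

lemma minus_eq_add: "x - y = x + (y::'a)"
  by (simp add: diff_eq_eq add.assoc)

lemma add_eq_zero_iff: "x + y = 0 \<longleftrightarrow> x = (y::'a)"
  by (metis minus_eq_add right_minus_eq)

lemma v_nz: "v \<noteq> 0"
  using v[of 0] f_0 by auto

lemma f_eq_0_iff: "f x = 0 \<longleftrightarrow> x = 0"
  using f_bij f_0 by (metis bij_pointE)

text \<open>Distinct triples of the configuration are distinct projective points, so two of them
  span a unique line, and any two columns of the generator matrix are independent. The case check
  rests on \<open>v \<noteq> 0\<close> and on \<open>f\<close> vanishing only at 0.\<close>

lemma cross3_nonzero:
  assumes "p \<in> oval \<union> ext" "r \<in> oval \<union> ext" "p \<noteq> r"
  shows "cross3 p r \<noteq> (0, 0, 0)"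
  using assms unfolding oval_def ext_def
  by (elim UnE insertE rangeE emptyE; auto simp: v_nz v_nz[symmetric] f_0 f_eq_0_iff)

lemma point_nonzero: "p \<in> oval \<union> ext \<Longrightarrow> p \<noteq> (0, 0, 0)"
  by (auto simp: oval_def ext_def)

lemma finite_oval [simp]: "finite oval" and finite_ext [simp]: "finite ext"
  by (auto simp: oval_def ext_def)

lemma card_oval: "card oval = q + 2"
proof -
  have "card (range (\<lambda>x. (f x, x, 1::'a))) = q"
    using card_field by (subst card_image) (auto simp: inj_on_def)
  moreover have "(1, 0, 0) \<notin> range (\<lambda>x. (f x, x, 1::'a))" "(0, 1, 0) \<notin> range (\<lambda>x. (f x, x, 1::'a))"
    by auto
  ultimately show ?thesis
    by (simp add: oval_def)
qed

lemma card_ext: "card ext = 3"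
  using v_nz by (simp add: ext_def)

lemma oval_ext_disjoint: "oval \<inter> ext = {}"
  by (auto simp: oval_def ext_def v_nz v_nz[symmetric] f_0 f_eq_0_iff)

lemma card_points: "card (oval \<union> ext) = q + 5"
  by (simp add: card_Un_disjoint oval_ext_disjoint card_oval card_ext)

lemma card_lines: "card lines = q ^ 3 - 1"
  by (simp add: card_Diff_singleton power3_eq_cube card_field)

lemma card_lines_through:
  assumes "p \<in> oval \<union> ext"
  shows "card {u\<in>lines. dot3 u p = 0} = q ^ 2 - 1"
proof -
  have "{u\<in>lines. dot3 u p = 0} = {u. dot3 u p = 0} - {(0, 0, 0)}"
    by auto
  moreover have "(0, 0, 0) \<in> {u. dot3 u p = 0}"
    by (cases p) simp
  ultimately show ?thesis
    using card_dot3_eq_0[OF point_nonzero[OF assms]] by (simp add: card_Diff_singleton card_field)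
qed

lemma card_lines_through_pair:
  assumes "p \<in> oval \<union> ext" "r \<in> oval \<union> ext" "p \<noteq> r"
  shows "card {u\<in>lines. dot3 u p = 0 \<and> dot3 u r = 0} = q - 1"
proof -
  have "{u\<in>lines. dot3 u p = 0 \<and> dot3 u r = 0} = {u. dot3 u p = 0 \<and> dot3 u r = 0} - {(0, 0, 0)}"
    by auto
  moreover have "(0, 0, 0) \<in> {u. dot3 u p = 0 \<and> dot3 u r = 0}"
    by (cases p, cases r) simp
  ultimately show ?thesis
    using card_dot3_eq_0_pair[OF cross3_nonzero[OF assms]] by (simp add: card_Diff_singleton card_field)
qed

lemma oval_mult_eq:
  "oval_mult (a, b, c) = card {x. a * f x + b * x + c = 0} + of_bool (a = 0) + of_bool (b = 0)"
proof -
  let ?A = "{x. a * f x + b * x + c = 0}"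
  have eq: "{p\<in>oval. dot3 (a, b, c) p = 0} =
    (\<lambda>x. (f x, x, 1)) ` ?A \<union> ((if a = 0 then {(1, 0, 0)} else {}) \<union> (if b = 0 then {(0, 1, 0)} else {}))"
    by (auto simp: oval_def)
  have "card ((\<lambda>x. (f x, x, 1::'a)) ` ?A) = card ?A"
    by (rule card_image) (auto simp: inj_on_def)
  then show ?thesis
    unfolding oval_mult_def eq by (subst card_Un_disjoint) auto
qed

text \<open>The hyperoval property. The line at infinity contains just the two oval points at
  infinity. A line through exactly one of these has one affine oval point, because \<open>f\<close>
  is bijective. On any other line, an affine oval point has exactly one partner by
  \<open>secant\<close>.\<close>

lemma oval_mult_cases:
  assumes "u \<in> lines"
  shows "oval_mult u = 0 \<or> oval_mult u = 2"
proof -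
  obtain a b c where u: "u = (a, b, c)"
    by (cases u)
  let ?A = "{x. a * f x + b * x + c = 0}"
  consider "a = 0" "b = 0" "c \<noteq> 0" | "a = 0" "b \<noteq> 0" | "a \<noteq> 0" "b = 0" | "a \<noteq> 0" "b \<noteq> 0"
    using assms u by auto
  then show ?thesis
  proof cases
    case 1
    then show ?thesis
      by (simp add: u oval_mult_eq)
  next
    case 2
    then have "?A = {c / b}"
      by (auto simp: add_eq_zero_iff field_simps)
    with 2 show ?thesis
      by (simp add: u oval_mult_eq)
  next
    case 3
    then have "?A = {x. f x = c / a}"
      by (auto simp: add_eq_zero_iff field_simps)
    also have "\<dots> = {inv_into UNIV f (c / a)}"
      by (simp add: set_eq_iff bij_inv_eq_iff[OF f_bij])
    finally show ?thesis
      using 3 by (simp add: u oval_mult_eq)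
  next
    case 4
    show ?thesis
    proof (cases "?A = {}")
      case False
      then obtain x where x: "a * f x + b * x + c = 0"
        by auto
      obtain t where t: "t \<noteq> 0" "f (x + t) + f x = b / a * t"
        and uniq: "\<And>t'. t' \<noteq> 0 \<Longrightarrow> f (x + t') + f x = b / a * t' \<Longrightarrow> t' = t"
        using secant[of "b / a" x] 4 by (metis divide_eq_0_iff)
      have shift: "x + t' \<in> ?A \<longleftrightarrow> f (x + t') + f x = b / a * t'" for t'
      proof -
        have "a * f (x + t') + b * (x + t') + c = a * (f (x + t') + f x) + b * t'"
        proof -
          \<comment> \<open>This is an identity of commutative rings, proved without
            \<open>add_self\<close>. The first bracket vanishes by the choice of \<open>x\<close>,
            the last term by characteristic two.\<close>
          have "a * f (x + t') + b * (x + t') + c =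
              a * (f (x + t') + f x) + b * t' + (a * f x + b * x + c) - a * (f x + f x)"
            by (simp add: algebra_simps del: add_self)
          then show ?thesis
            by (simp add: x)
        qed
        then have "x + t' \<in> ?A \<longleftrightarrow> a * (f (x + t') + f x) = b * t'"
          using add_eq_zero_iff[of "a * (f (x + t') + f x)" "b * t'"] by (simp only: mem_Collect_eq)
        then show ?thesis
          using 4 by (simp add: eq_divide_eq mult.commute)
      qed
      have "?A = {x, x + t}"
      proof (intro equalityI subsetI)
        fix y assume "y \<in> ?A"
        then show "y \<in> {x, x + t}"
          using shift[of "y - x"] uniq[of "y - x"] by (cases "y = x") auto
      qed (use x t shift[of t] in auto)
      with 4 t(1) show ?thesis
        by (simp add: u oval_mult_eq)
    qed (use 4 in \<open>simp add: u oval_mult_eq\<close>)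
  qed
qed

lemma ext_mult_eq:
  "ext_mult (a, b, c) = of_bool (a = b) + of_bool (b * v = c) + of_bool (a * v = c)"
proof -
  have "{p\<in>ext. dot3 (a, b, c) p = 0} =
    (if a = b then {(1, 1, 0)} else {}) \<union> (if b * v = c then {(0, v, 1)} else {}) \<union>
    (if a * v = c then {(v, 0, 1)} else {})"
    by (auto simp: ext_def add_eq_zero_iff)
  then show ?thesis
    using v_nz by (auto simp: ext_mult_def)
qed

text \<open>Since \<open>v \<noteq> 0\<close>, any two of the three equations in
  \<open>ext_mult_eq\<close> imply the third, so a line never carries exactly two extra points. All
  three hold only on multiples of \<open>(1, 1, v)\<close>, and an oval point there would give
  \<open>f x + x = v\<close>.\<close>

lemma mult_cases:
  assumes "u \<in> lines"
  shows "(oval_mult u, ext_mult u) \<in> {(0, 0), (0, 1), (0, 3), (2, 0), (2, 1)}"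
    and "ext_mult u = 3 \<longleftrightarrow> (\<exists>t. u = (t, t, t * v))"
proof -
  obtain a b c where u: "u = (a, b, c)"
    by (cases u)
  have e: "ext_mult u \<in> {0, 1, 3}"
    using v_nz by (auto simp: u ext_mult_eq)
  show 3: "ext_mult u = 3 \<longleftrightarrow> (\<exists>t. u = (t, t, t * v))"
    by (auto simp: u ext_mult_eq)
  have "oval_mult u = 0" if e3: "ext_mult u = 3"
  proof -
    obtain t where t: "u = (t, t, t * v)"
      using 3 e3 by blast
    then have nz: "t \<noteq> 0"
      using assms by auto
    have "t * f x + t * x + t * v = t * (f x + x + v)" for x
      by (simp add: algebra_simps)
    then show ?thesis
      using nz v by (simp add: t oval_mult_eq add_eq_zero_iff)
  qed
  then show "(oval_mult u, ext_mult u) \<in> {(0, 0), (0, 1), (0, 3), (2, 0), (2, 1)}"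
    using e oval_mult_cases[OF assms] by auto
qed

section \<open>Counting lines by incidence type\<close>

definition type_count where
  "type_count k = real (card {u\<in>lines. (oval_mult u, ext_mult u) = k})"

text \<open>Grouping the lines by type makes each weight function \<open>g\<close> yield one linear
  equation between the five counts. The counts are real so that the system can be solved by
  subtraction and division.\<close>

lemma sum_lines_eq:
  "(\<Sum>u\<in>lines. real (g (oval_mult u) (ext_mult u))) =
    g 0 0 * type_count (0, 0) + g 0 1 * type_count (0, 1) + g 0 3 * type_count (0, 3) +
    g 2 0 * type_count (2, 0) + g 2 1 * type_count (2, 1)" for g :: "nat \<Rightarrow> nat \<Rightarrow> nat"
proof -
  let ?K = "{(0, 0), (0, 1), (0, 3), (2, 0), (2, 1)} :: (nat \<times> nat) set"
  have "(\<Sum>u\<in>lines. real (g (oval_mult u) (ext_mult u))) =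
    (\<Sum>k\<in>?K. \<Sum>u | u \<in> lines \<and> (oval_mult u, ext_mult u) = k. real (g (oval_mult u) (ext_mult u)))"
  proof (rule sum.group[symmetric])
    show "(\<lambda>u. (oval_mult u, ext_mult u)) ` lines \<subseteq> ?K"
      using mult_cases(1) by blast
  qed simp_all
  also have "\<dots> = (\<Sum>k\<in>?K. g (fst k) (snd k) * type_count k)"
  proof (rule sum.cong[OF refl])
    fix k :: "nat \<times> nat"
    have "(\<Sum>u | u \<in> lines \<and> (oval_mult u, ext_mult u) = k. real (g (oval_mult u) (ext_mult u))) =
        (\<Sum>u | u \<in> lines \<and> (oval_mult u, ext_mult u) = k. real (g (fst k) (snd k)))"
      by (rule sum.cong) auto
    then show "(\<Sum>u | u \<in> lines \<and> (oval_mult u, ext_mult u) = k. real (g (oval_mult u) (ext_mult u))) =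
        g (fst k) (snd k) * type_count k"
      by (simp add: type_count_def)
  qed
  finally show ?thesis
    by simp
qed

lemma type_counts:
  shows "type_count (0, 3) = real q - 1"
    and "type_count (2, 1) = 3 * (real q - 1) * (real q + 2) / 2"
    and "type_count (2, 0) = (real q - 1) * (real q + 2) * (real q - 2) / 2"
    and "type_count (0, 1) = 3 * (real q - 1) * (real q - 2) / 2"
    and "type_count (0, 0) = (real q - 1) * (real q - 2)\<^sup>2 / 2"
proof -
  have q: "q \<ge> 1"
    unfolding card_field[symmetric] by (simp add: Suc_leI)
  then have q2: "real (q ^ 2 - 1) = real q ^ 2 - 1" and q1: "real (q - 1) = real q - 1"
    by (simp_all add: of_nat_diff)
  \<comment> \<open>Type (0, 3) is counted directly: these are the nonzero multiples of
    \<open>(1, 1, v)\<close>. Four equations then determine the other four counts.\<close>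
  have "{u\<in>lines. (oval_mult u, ext_mult u) = (0, 3)} = (\<lambda>t. (t, t, t * v)) ` (UNIV - {0})"
  proof (intro equalityI subsetI)
    fix u assume u: "u \<in> {u\<in>lines. (oval_mult u, ext_mult u) = (0, 3)}"
    then obtain t where "u = (t, t, t * v)"
      using mult_cases(2)[of u] by auto
    with u show "u \<in> (\<lambda>t. (t, t, t * v)) ` (UNIV - {0})"
      by auto
  next
    fix u assume "u \<in> (\<lambda>t. (t, t, t * v)) ` (UNIV - {0})"
    then obtain t where t: "t \<noteq> 0" "u = (t, t, t * v)"
      by auto
    then have "u \<in> lines"
      by auto
    moreover from this have "ext_mult u = 3"
      using mult_cases(2) t by auto
    ultimately show "u \<in> {u\<in>lines. (oval_mult u, ext_mult u) = (0, 3)}"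
      using mult_cases(1)[of u] by auto
  qed
  then show n03: "type_count (0, 3) = real q - 1"
    using q by (simp add: type_count_def card_image inj_on_def card_Diff_singleton card_field of_nat_diff)
  have S1: "real q ^ 3 - 1 = type_count (0, 0) + type_count (0, 1) + type_count (0, 3) +
      type_count (2, 0) + type_count (2, 1)"
    using sum_lines_eq[of "\<lambda>_ _. 1"] q by (simp add: card_lines of_nat_diff)
  \<comment> \<open>Incident pairs of a line and an oval point; each point lies on
    \<open>q ^ 2 - 1\<close> nonzero triples.\<close>
  have "(\<Sum>u\<in>lines. oval_mult u) = (\<Sum>p\<in>oval. card {u\<in>lines. dot3 u p = 0})"
    unfolding oval_mult_def by (rule sum_card_swap) auto
  also have "\<dots> = (\<Sum>p\<in>oval. q ^ 2 - 1)"
    by (intro sum.cong refl card_lines_through) simp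
  also have "\<dots> = (q + 2) * (q ^ 2 - 1)"
    by (simp add: card_oval)
  finally have "real (\<Sum>u\<in>lines. oval_mult u) = (real q + 2) * (real q ^ 2 - 1)"
    by (simp only: of_nat_mult of_nat_add of_nat_numeral q1 q2)
  then have S2: "(real q + 2) * (real q ^ 2 - 1) = 2 * type_count (2, 0) + 2 * type_count (2, 1)"
    using sum_lines_eq[of "\<lambda>h _. h"] by simp
  have "(\<Sum>u\<in>lines. ext_mult u) = (\<Sum>p\<in>ext. card {u\<in>lines. dot3 u p = 0})"
    unfolding ext_mult_def by (rule sum_card_swap) auto
  also have "\<dots> = (\<Sum>p\<in>ext. q ^ 2 - 1)"
    by (intro sum.cong refl card_lines_through) simp
  also have "\<dots> = 3 * (q ^ 2 - 1)"
    by (simp add: card_ext)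
  finally have "real (\<Sum>u\<in>lines. ext_mult u) = 3 * (real q ^ 2 - 1)"
    by (simp only: of_nat_mult of_nat_add of_nat_numeral q1 q2)
  then have S3: "3 * (real q ^ 2 - 1) = type_count (0, 1) + 3 * type_count (0, 3) + type_count (2, 1)"
    using sum_lines_eq[of "\<lambda>_ e. e"] by simp
  \<comment> \<open>Lines together with an oval point and an extra point on them. The two points
    differ and span one projective line, that is \<open>q - 1\<close> triples. Only type (2, 1)
    contributes, so the system becomes triangular and is solved from this equation
    backwards.\<close>
  have "(\<Sum>u\<in>lines. oval_mult u * ext_mult u) =
      (\<Sum>u\<in>lines. card {k\<in>oval \<times> ext. dot3 u (fst k) = 0 \<and> dot3 u (snd k) = 0})"
    unfolding oval_mult_def ext_mult_def card_cartesian_product[symmetric]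
    by (intro sum.cong refl arg_cong[where f = card]) auto
  also have "\<dots> = (\<Sum>k\<in>oval \<times> ext. card {u\<in>lines. dot3 u (fst k) = 0 \<and> dot3 u (snd k) = 0})"
    by (rule sum_card_swap) auto
  also have "\<dots> = (\<Sum>k\<in>oval \<times> ext. q - 1)"
    by (intro sum.cong refl card_lines_through_pair) (use oval_ext_disjoint in auto)
  also have "\<dots> = (q + 2) * 3 * (q - 1)"
    by (simp add: card_oval card_ext)
  finally have "real (\<Sum>u\<in>lines. oval_mult u * ext_mult u) = (real q + 2) * 3 * (real q - 1)"
    by (simp only: of_nat_mult of_nat_add of_nat_numeral q1 q2)
  then have S4: "(real q + 2) * 3 * (real q - 1) = 2 * type_count (2, 1)"
    using sum_lines_eq[of "\<lambda>h e. h * e"] by simp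
  show n21: "type_count (2, 1) = 3 * (real q - 1) * (real q + 2) / 2"
    using S4 by (simp add: field_simps)
  show n20: "type_count (2, 0) = (real q - 1) * (real q + 2) * (real q - 2) / 2"
    using S2 n21 by (simp add: field_simps power2_eq_square)
  show n01: "type_count (0, 1) = 3 * (real q - 1) * (real q - 2) / 2"
    using S3 n21 n03 by (simp add: field_simps power2_eq_square)
  show "type_count (0, 0) = (real q - 1) * (real q - 2)\<^sup>2 / 2"
    using S1 n21 n03 n20 n01 by (simp add: field_simps power2_eq_square power3_eq_cube)
qed

end

section \<open>The code, its dimension and its minimum distance\<close>

locale oval_code = extended_hyperoval "poly f" v q
  for f :: "'a::{field,finite} poly" and v :: 'a and q :: nat +
  fixes \<alpha> :: "nat \<Rightarrow> 'a"
  assumes \<alpha>: "bij_betw \<alpha> {1..q} UNIV"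
begin

abbreviation "G \<equiv> gen_matrix q \<alpha> f v"

abbreviation "C \<equiv> code_generated_by G"

text \<open>The successor reconciles vector indices, which start at 0, with the enumeration
  \<open>\<alpha>\<close>, which starts at 1.\<close>

definition column :: "nat \<Rightarrow> 'a \<times> 'a \<times> 'a" where
  "column i = (if i < q then (poly f (\<alpha> (Suc i)), \<alpha> (Suc i), 1)
     else [(1, 0, 0), (0, 1, 0), (1, 1, 0), (0, v, 1), (v, 0, 1)] ! (i - q))"

definition codeword :: "'a \<times> 'a \<times> 'a \<Rightarrow> 'a vec" where
  "codeword u = vec (q + 5) (\<lambda>i. dot3 u (column i))"

lemma less_add_5_cases:
  assumes "i < q + 5"
  obtains "i < q" | "i = q" | "i = q + 1" | "i = q + 2" | "i = q + 3" | "i = q + 4"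
  using assms by linarith

lemma column_last [simp]:
  "column q = (1, 0, 0)" "column (q + 1) = (0, 1, 0)" "column (q + 2) = (1, 1, 0)"
  "column (q + 3) = (0, v, 1)" "column (q + 4) = (v, 0, 1)" "column (Suc q) = (0, 1, 0)"
  "column (Suc (Suc q)) = (1, 1, 0)"
  by (simp_all add: column_def)

lemma G_carrier [simp]: "G \<in> carrier_mat 3 (q + 5)"
  unfolding gen_matrix_def mat_of_rows_list_def by (rule carrier_matI) simp_all

lemma G_dims [simp]: "dim_row G = 3" "dim_col G = q + 5"
  using G_carrier by (simp_all only: carrier_matD)

lemma column_eq:
  assumes "i < q + 5"
  shows "column i = (G $$ (0, i), G $$ (1, i), G $$ (2, i))"
  using assms
  by (cases rule: less_add_5_cases)
    (simp_all add: column_def gen_matrix_def mat_of_rows_list_def nth_append del: upt_Suc)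

lemma transpose_G_mult:
  assumes "y \<in> carrier_vec 3"
  shows "G\<^sup>T *\<^sub>v y = codeword (y $ 0, y $ 1, y $ 2)"
proof (rule eq_vecI)
  fix i assume "i < dim_vec (codeword (y $ 0, y $ 1, y $ 2))"
  then have i: "i < q + 5"
    by (simp add: codeword_def)
  then have "(G\<^sup>T *\<^sub>v y) $ i = (\<Sum>j\<in>{0..<3}. G $$ (j, i) * y $ j)"
    using assms by (simp add: scalar_prod_def)
  also have "\<dots> = codeword (y $ 0, y $ 1, y $ 2) $ i"
    using i by (simp add: codeword_def column_eq numeral_3_eq_3 numeral_2_eq_2 mult.commute)
  finally show "(G\<^sup>T *\<^sub>v y) $ i = codeword (y $ 0, y $ 1, y $ 2) $ i" .
qed (simp add: codeword_def)

lemma inj_codeword: "inj codeword"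
proof (rule injI)
  fix u u' assume eq: "codeword u = codeword u'"
  obtain a b c a' b' c' where u: "u = (a, b, c)" "u' = (a', b', c')"
    by (cases u, cases u')
  have "dot3 u (column i) = dot3 u' (column i)" if "i < q + 5" for i
    using arg_cong[OF eq, of "\<lambda>w. w $ i"] that by (simp add: codeword_def)
  \<comment> \<open>The columns (1, 0, 0), (0, 1, 0) and (0, v, 1) form a basis.\<close>
  from this[of q] this[of "q + 1"] this[of "q + 3"] show "u = u'"
    by (simp add: u)
qed

lemma code_eq_image: "C = (*\<^sub>v) G\<^sup>T ` carrier_vec 3"
  by (rule code_generated_by_eq[OF G_carrier])

lemma code_eq: "C = range codeword"
proof -
  have "\<exists>y\<in>carrier_vec 3. u = (y $ 0, y $ 1, y $ 2)" for u :: "'a \<times> 'a \<times> 'a"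
  proof -
    obtain a b c where "u = (a, b, c)"
      by (cases u)
    then show ?thesis
      by (intro bexI[of _ "vec 3 ((!) [a, b, c])"]) simp_all
  qed
  then have surj: "(\<lambda>y. (y $ 0, y $ 1, y $ 2)) ` carrier_vec 3 = (UNIV :: ('a \<times> 'a \<times> 'a) set)"
    by blast
  have "C = (\<lambda>y. codeword (y $ 0, y $ 1, y $ 2)) ` carrier_vec 3"
    unfolding code_eq_image by (rule image_cong) (simp_all only: transpose_G_mult)
  also have "\<dots> = codeword ` (\<lambda>y. (y $ 0, y $ 1, y $ 2)) ` carrier_vec 3"
    by (simp only: image_image)
  finally show ?thesis
    by (simp only: surj)
qed

lemma codeword_0: "codeword (0, 0, 0) = 0\<^sub>v (q + 5)"
proof -
  have "dot3 (0, 0, 0) p = 0" for p :: "'a \<times> 'a \<times> 'a"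
    by (cases p) simp
  then show ?thesis
    by (auto simp: codeword_def)
qed

lemma nonzero_codewords: "C - {0\<^sub>v (q + 5)} = codeword ` lines"
  unfolding code_eq codeword_0[symmetric] using inj_codeword by (auto dest: injD)

lemma code_dim_C: "code_dim (q + 5) C = 3"
  unfolding code_eq_image
proof (rule code_dim_image_of_inj)
  show "inj_on ((*\<^sub>v) G\<^sup>T) (carrier_vec 3)"
  proof (rule inj_onI)
    fix y y' :: "'a vec" assume y: "y \<in> carrier_vec 3" "y' \<in> carrier_vec 3"
      and "G\<^sup>T *\<^sub>v y = G\<^sup>T *\<^sub>v y'"
    then have "y $ 0 = y' $ 0" "y $ 1 = y' $ 1" "y $ 2 = y' $ 2"
      using injD[OF inj_codeword] by (auto simp: transpose_G_mult)
    then have "y $ i = y' $ i" if "i < 3" for i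
      using that by (auto simp: less_Suc_eq numeral_3_eq_3 numeral_2_eq_2)
    then show "y = y'"
      using y by (intro eq_vecI) auto
  qed
qed simp

lemma linear_C: "linear_code (q + 5) C"
  unfolding code_eq_image by (rule linear_code_image) simp

lemma column_image: "column ` {..<q + 5} = oval \<union> ext"
proof -
  have "{..<q + 5} = {..<q} \<union> {q, q + 1, q + 2, q + 3, q + 4}"
    by auto
  then have "column ` {..<q + 5} = column ` {..<q} \<union>
      {(1, 0, 0), (0, 1, 0), (1, 1, 0), (0, v, 1), (v, 0, 1)}"
    by (simp only: image_Un image_insert image_empty column_last)
  also have "column ` {..<q} = (\<lambda>x. (poly f x, x, 1)) ` \<alpha> ` Suc ` {..<q}"
    unfolding image_image by (rule image_cong) (simp_all add: column_def)
  also have "\<alpha> ` Suc ` {..<q} = UNIV"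
    using \<alpha> by (simp add: bij_betw_def image_Suc_lessThan)
  finally show ?thesis
    by (simp only: oval_def ext_def Un_insert_left Un_insert_right sup_bot_right insert_commute)
qed

text \<open>By \<open>card_points\<close> the image has as many elements as there are
  indices.\<close>

lemma inj_on_column: "inj_on column {..<q + 5}"
  by (rule eq_card_imp_inj_on) (simp_all add: column_image card_points)

text \<open>A coordinate is zero exactly when its column lies on the line \<open>u\<close>, and
  different coordinates belong to different points.\<close>

lemma hamming_weight_codeword:
  "hamming_weight (codeword u) = q + 5 - (oval_mult u + ext_mult u)"
proof -
  let ?Z = "{i\<in>{..<q + 5}. dot3 u (column i) = 0}"
  have "column ` ?Z = {p\<in>column ` {..<q + 5}. dot3 u p = 0}"
    by auto
  also have "\<dots> = {p\<in>oval. dot3 u p = 0} \<union> {p\<in>ext. dot3 u p = 0}"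
    by (auto simp: column_image)
  finally have "card (column ` ?Z) = oval_mult u + ext_mult u"
    unfolding oval_mult_def ext_mult_def using oval_ext_disjoint
    by (auto intro!: card_Un_disjoint)
  moreover have "card (column ` ?Z) = card ?Z"
    by (intro card_image inj_on_subset[OF inj_on_column]) auto
  moreover have "{i. i < dim_vec (codeword u) \<and> codeword u $ i \<noteq> 0} = {..<q + 5} - ?Z"
    by (auto simp: codeword_def)
  moreover have "card ({..<q + 5} - ?Z) = q + 5 - card ?Z"
    by (subst card_Diff_subset) auto
  ultimately show ?thesis
    unfolding hamming_weight_def by simp
qed

lemma min_distance_C: "min_distance (q + 5) C = q + 2"
  unfolding min_distance_def nonzero_codewords
proof (rule Min_eqI)
  fix w assume "w \<in> hamming_weight ` codeword ` lines"
  then obtain u where u: "u \<in> lines" "w = hamming_weight (codeword u)"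
    by blast
  then show "q + 2 \<le> w"
    using mult_cases(1)[OF u(1)] by (auto simp: hamming_weight_codeword)
next
  \<comment> \<open>The line of the three extra points attains the bound; no type has more than
    three points in total.\<close>
  have "(1, 1, v) \<in> lines"
    by simp
  moreover from this have "ext_mult (1, 1, v) = 3"
    by (subst mult_cases(2)) (auto intro: exI[of _ 1])
  ultimately have "hamming_weight (codeword (1, 1, v)) = q + 2"
    using mult_cases(1)[of "(1, 1, v)"] by (auto simp: hamming_weight_codeword)
  then show "q + 2 \<in> hamming_weight ` codeword ` lines"
    using \<open>(1, 1, v) \<in> lines\<close> by (metis imageI)
qed auto

lemma nkd_C: "nkd_code (q + 5) 3 (q + 2) C"
proof -
  have "(1, 1, v) \<in> lines"
    by simp
  then have "C - {0\<^sub>v (q + 5)} \<noteq> {}"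
    unfolding nonzero_codewords by blast
  then show ?thesis
    by (auto simp: nkd_code_def linear_C code_dim_C min_distance_C)
qed

section \<open>The dual code and the NMDS property\<close>

lemma sum_lessThan_add_5:
  "(\<Sum>i<q + 5. g i) = (\<Sum>i<q. g i) + g q + g (q + 1) + g (q + 2) + g (q + 3) + g (q + 4)"
  for g :: "nat \<Rightarrow> 'a"
  by (simp add: eval_nat_numeral add.assoc)

lemma G_mult:
  assumes "x \<in> carrier_vec (q + 5)"
  shows "G *\<^sub>v x = vec_of_list
    [\<Sum>i<q + 5. fst (column i) * x $ i, \<Sum>i<q + 5. fst (snd (column i)) * x $ i,
     \<Sum>i<q + 5. snd (snd (column i)) * x $ i]"
proof (rule eq_vecI, goal_cases)
  case (1 j)
  then have "j < 3"
    by simp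
  then have eq: "(G *\<^sub>v x) $ j = (\<Sum>i<q + 5. G $$ (j, i) * x $ i)"
    using assms by (simp add: scalar_prod_def lessThan_atLeast0)
  consider "j = 0" | "j = 1" | "j = 2"
    using \<open>j < 3\<close> by linarith
  then show ?case
    unfolding eq
    by cases (simp_all add: column_eq numeral_2_eq_2 del: sum.lessThan_Suc)
qed simp

lemma kernel_iff:
  "x \<in> mat_kernel G \<longleftrightarrow> x \<in> carrier_vec (q + 5) \<and> (\<Sum>i<q + 5. fst (column i) * x $ i) = 0 \<and>
    (\<Sum>i<q + 5. fst (snd (column i)) * x $ i) = 0 \<and> (\<Sum>i<q + 5. snd (snd (column i)) * x $ i) = 0"
proof -
  have "vec_of_list [a, b, c] = 0\<^sub>v 3 \<longleftrightarrow> a = 0 \<and> b = 0 \<and> c = 0" for a b c :: 'a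
    by (auto simp: vec_eq_iff less_Suc_eq numeral_3_eq_3)
  then show ?thesis
    using G_carrier by (auto simp: mat_kernel_def G_mult simp del: sum.lessThan_Suc)
qed

lemma G_surj: "(*\<^sub>v) G ` carrier_vec (q + 5) = carrier_vec 3"
proof (intro equalityI subsetI)
  fix y :: "'a vec" assume y: "y \<in> carrier_vec 3"
  \<comment> \<open>Coordinates of \<open>y\<close> in the basis formed by columns \<open>q\<close>,
    \<open>q + 1\<close> and \<open>q + 3\<close>; the correction by \<open>v * y $ 2\<close>
    cancels the middle entry of (0, v, 1).\<close>
  define x where "x = vec (q + 5) (\<lambda>i. if i = q then y $ 0 else if i = q + 1 then y $ 1 - v * y $ 2
    else if i = q + 3 then y $ 2 else 0)"
  have x: "x \<in> carrier_vec (q + 5)"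
    by (simp add: x_def)
  have "G *\<^sub>v x = vec_of_list [y $ 0, y $ 1, y $ 2]"
    unfolding G_mult[OF x] sum_lessThan_add_5 by (simp add: x_def)
  also have "\<dots> = y"
    using y by (intro eq_vecI) (auto simp: less_Suc_eq numeral_3_eq_3 numeral_2_eq_2)
  finally show "y \<in> (*\<^sub>v) G ` carrier_vec (q + 5)"
    using x by blast
qed (use mult_mat_vec_carrier[OF G_carrier] in blast)

lemma code_dim_kernel: "code_dim (q + 5) (mat_kernel G) = q + 2"
  using rank_nullity_mat[OF G_carrier] by (simp add: G_surj code_dim_carrier_vec)

text \<open>A nonzero word of weight at most 2 would be a linear relation between two columns, which
  represent distinct points.\<close>

lemma hamming_weight_kernel_ge:
  assumes x: "x \<in> mat_kernel G" "x \<noteq> 0\<^sub>v (q + 5)"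
  shows "hamming_weight x \<ge> 3"
proof (rule ccontr)
  define S where "S = {i. i < q + 5 \<and> x $ i \<noteq> 0}"
  assume "\<not> hamming_weight x \<ge> 3"
  then have S: "card S \<le> 2" "finite S"
    using x by (auto simp: hamming_weight_def S_def kernel_iff)
  obtain i where i: "i < q + 5" "x $ i \<noteq> 0"
    using x by (auto simp: kernel_iff vec_eq_iff)
  \<comment> \<open>Padding the support to two indices treats weights 1 and 2 together.\<close>
  have "\<exists>j<q + 5. j \<noteq> i \<and> S \<subseteq> {i, j}"
  proof (cases "S = {i}")
    case True
    then show ?thesis
      by (intro exI[of _ "if i = 0 then 1 else 0"]) auto
  next
    case False
    then obtain j where j: "j \<in> S" "j \<noteq> i"
      using i by (auto simp: S_def)
    then have "{i, j} \<subseteq> S" "card {i, j} = 2"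
      using i by (auto simp: S_def)
    then have "S = {i, j}"
      using S by (metis card_seteq)
    then show ?thesis
      using j by (auto simp: S_def)
  qed
  then obtain j where j: "j < q + 5" "j \<noteq> i" "S \<subseteq> {i, j}"
    by blast
  have sum: "(\<Sum>k<q + 5. g k * x $ k) = g i * x $ i + g j * x $ j" for g
  proof -
    have "(\<Sum>k<q + 5. g k * x $ k) = (\<Sum>k\<in>{i, j}. g k * x $ k)"
      by (rule sum.mono_neutral_right) (use i j in \<open>auto simp: S_def\<close>)
    then show ?thesis
      using j by simp
  qed
  obtain a b c a' b' c' where c: "column i = (a, b, c)" "column j = (a', b', c')"
    by (cases "column i", cases "column j")
  have eq: "a * x $ i + a' * x $ j = 0" "b * x $ i + b' * x $ j = 0" "c * x $ i + c' * x $ j = 0"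
    using x(1) by (simp_all add: kernel_iff sum c)
  \<comment> \<open>Eliminating \<open>x $ j\<close> shows that every coordinate of the cross
    product is annihilated by the nonzero entry \<open>x $ i\<close>.\<close>
  have "(b * c' - c * b') * x $ i = c' * (b * x $ i + b' * x $ j) - b' * (c * x $ i + c' * x $ j)"
    "(c * a' - a * c') * x $ i = a' * (c * x $ i + c' * x $ j) - c' * (a * x $ i + a' * x $ j)"
    "(a * b' - b * a') * x $ i = b' * (a * x $ i + a' * x $ j) - a' * (b * x $ i + b' * x $ j)"
    by (simp_all add: algebra_simps)
  then have "cross3 (column i) (column j) = (0, 0, 0)"
    using i by (simp add: eq c)
  moreover have "column i \<noteq> column j"
    using inj_on_column i j by (auto dest: inj_onD)
  moreover have "column i \<in> oval \<union> ext" "column j \<in> oval \<union> ext"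
    unfolding column_image[symmetric] using i j by auto
  ultimately show False
    using cross3_nonzero by blast
qed

lemma kernel_weight_3: "\<exists>x\<in>mat_kernel G. hamming_weight x = 3"
proof
  \<comment> \<open>The collinearity relation v(1, 1, 0) + (0, v, 1) + (v, 0, 1) = 0 in
    characteristic two.\<close>
  let ?x = "vec (q + 5) (\<lambda>i. if i = q + 2 then v else if i = q + 3 \<or> i = q + 4 then 1 else 0)"
  show "?x \<in> mat_kernel G"
    unfolding kernel_iff sum_lessThan_add_5 using char2 by simp
  have "{i. i < dim_vec ?x \<and> ?x $ i \<noteq> 0} = {q + 2, q + 3, q + 4}"
    using v_nz by (auto split: if_splits)
  then show "hamming_weight ?x = 3"
    by (simp add: hamming_weight_def)
qed

lemma min_distance_kernel: "min_distance (q + 5) (mat_kernel G) = 3"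
  and kernel_nontrivial: "mat_kernel G \<noteq> {0\<^sub>v (q + 5)}"
proof -
  obtain x where x: "x \<in> mat_kernel G" "hamming_weight x = 3"
    using kernel_weight_3 by blast
  have "hamming_weight (0\<^sub>v (q + 5) :: 'a vec) = 0"
    by (simp add: hamming_weight_def)
  then have nz: "x \<noteq> 0\<^sub>v (q + 5)"
    using x by auto
  show "mat_kernel G \<noteq> {0\<^sub>v (q + 5)}"
    using x nz by auto
  have "hamming_weight y \<le> q + 5" if "y \<in> mat_kernel G" for y
  proof -
    have "dim_vec y = q + 5"
      using that by (simp add: kernel_iff)
    then show ?thesis
      unfolding hamming_weight_def using card_mono[of "{..<q + 5}" "{i. i < dim_vec y \<and> y $ i \<noteq> 0}"]
      by auto
  qed
  then have "finite (hamming_weight ` (mat_kernel G - {0\<^sub>v (q + 5)}))"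
    by (intro finite_subset[OF _ finite_atMost[of "q + 5"]]) auto
  then show "min_distance (q + 5) (mat_kernel G) = 3"
    unfolding min_distance_def
    by (rule Min_eqI) (use hamming_weight_kernel_ge x nz in \<open>auto intro!: image_eqI[of _ _ x]\<close>)
qed

text \<open>The defects are (q + 5) - 3 + 1 - (q + 2) = 1 and, for the dual, (q + 5) - (q + 2) + 1 -
  3 = 1.\<close>

lemma NMDS_C: "NMDS (q + 5) C"
proof -
  have "dual_code (q + 5) C = mat_kernel G"
    by (rule dual_code_generated_by[OF G_carrier])
  then show ?thesis
    using nkd_C kernel_nontrivial
    by (simp add: NMDS_def nkd_code_def singleton_defect_def code_dim_kernel min_distance_kernel)
qed

section \<open>The weight enumerator\<close>

lemma weight_count_C:
  assumes "i \<ge> 1"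
  shows "real (weight_count C i) = of_bool (i = q + 5) * type_count (0, 0) +
    of_bool (i = q + 4) * type_count (0, 1) + of_bool (i = q + 3) * type_count (2, 0) +
    of_bool (i = q + 2) * (type_count (0, 3) + type_count (2, 1))"
proof -
  let ?w = "\<lambda>h e. q + 5 - (h + e)"
  \<comment> \<open>As \<open>i \<ge> 1\<close>, the zero word is not counted and only triples in
    \<open>lines\<close> remain.\<close>
  have "hamming_weight (codeword (0, 0, 0)) = 0"
    by (simp add: codeword_0 hamming_weight_def)
  then have "hamming_weight (codeword u) = i \<longleftrightarrow> u \<in> lines \<and> ?w (oval_mult u) (ext_mult u) = i" for u
    using assms unfolding hamming_weight_codeword[symmetric] by (cases "u = (0, 0, 0)") simp_all
  then have "{c \<in> C. hamming_weight c = i} =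
      codeword ` {u\<in>lines. ?w (oval_mult u) (ext_mult u) = i}"
    unfolding code_eq by blast
  then have "weight_count C i = card {u\<in>lines. ?w (oval_mult u) (ext_mult u) = i}"
    unfolding weight_count_def
    by (simp add: card_image inj_on_subset[OF inj_codeword])
  also have "\<dots> = (\<Sum>u\<in>lines. of_bool (?w (oval_mult u) (ext_mult u) = i))"
    by (simp add: Int_def)
  finally have "real (weight_count C i) =
      (\<Sum>u\<in>lines. real (of_bool (?w (oval_mult u) (ext_mult u) = i)))"
    by simp
  \<comment> \<open>Types (0, 3) and (2, 1) both have three points on the line, hence the same
    weight \<open>q + 2\<close>.\<close>
  also note sum_lines_eq[of "\<lambda>h e. of_bool (?w h e = i)"]
  finally show ?thesis
    by (auto simp: algebra_simps)
qed

lemma weight_enumerator_C: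
  "weight_enumerator (q + 5) C =
     1 + monom ((real q - 1) * (3 * real q + 8) / 2) (q + 2)
       + monom ((real q - 1) * (real q + 2) * (real q - 2) / 2) (q + 3)
       + monom (3 * (real q - 1) * (real q - 2) / 2) (q + 4)
       + monom ((real q - 1) * (real q - 2)\<^sup>2 / 2) (q + 5)"
proof -
  \<comment> \<open>The first coefficient merges two types: (q - 1) + 3(q - 1)(q + 2)/2 = (q - 1)(3q
    + 8)/2.\<close>
  have w: "real (weight_count C (q + 2)) = (real q - 1) * (3 * real q + 8) / 2"
    "real (weight_count C (q + 3)) = (real q - 1) * (real q + 2) * (real q - 2) / 2"
    "real (weight_count C (q + 4)) = 3 * (real q - 1) * (real q - 2) / 2"
    "real (weight_count C (q + 5)) = (real q - 1) * (real q - 2)\<^sup>2 / 2"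
    using weight_count_C[of "q + 2"] weight_count_C[of "q + 3"] weight_count_C[of "q + 4"]
      weight_count_C[of "q + 5"]
    unfolding type_counts by (simp_all add: field_simps)
  have "(\<Sum>i=1..q + 5. monom (real (weight_count C i)) i) =
      (\<Sum>i\<in>{q + 2, q + 3, q + 4, q + 5}. monom (real (weight_count C i)) i)"
    by (rule sum.mono_neutral_right) (auto simp: weight_count_C)
  also have "\<dots> = monom (real (weight_count C (q + 2))) (q + 2) +
      monom (real (weight_count C (q + 3))) (q + 3) + monom (real (weight_count C (q + 4))) (q + 4) +
      monom (real (weight_count C (q + 5))) (q + 5)"
    by (simp add: add.assoc)
  finally show ?thesis
    by (simp only: weight_enumerator_def w add.assoc)
qed

end

theorem theorem3p2:
  fixes f :: "'a::{field,finite} poly" and v :: 'a and \<alpha> :: "nat \<Rightarrow> 'a" and m q :: nat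
  assumes "m > 0" and "q = 2 ^ m" and "CARD('a) = q"
    and "o_polynomial f"
    and "v \<in> UNIV - {poly f x + x | x. x \<in> UNIV}"
    and "bij_betw \<alpha> {1..q} UNIV" and "\<alpha> q = 0"
  shows "nkd_code (q + 5) 3 (q + 2) (code_generated_by (gen_matrix q \<alpha> f v)) \<and>
    NMDS (q + 5) (code_generated_by (gen_matrix q \<alpha> f v)) \<and>
    weight_enumerator (q + 5) (code_generated_by (gen_matrix q \<alpha> f v)) =
      1 + monom ((real q - 1) * (3 * real q + 8) / 2) (q + 2)
        + monom ((real q - 1) * (real q + 2) * (real q - 2) / 2) (q + 3)
        + monom (3 * (real q - 1) * (real q - 2) / 2) (q + 4)
        + monom ((real q - 1) * (real q - 2)\<^sup>2 / 2) (q + 5)"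
proof -
  have char2: "(1::'a) + 1 = 0"
    by (rule one_plus_one_eq_0_of_card_power_2[of m]) (simp add: assms)
  interpret oval_code f v q \<alpha>
  proof unfold_locales
    show "\<exists>!t. t \<noteq> 0 \<and> poly f (a + t) + poly f a = s * t" if "s \<noteq> 0" for a s
      by (rule o_polynomial_secant[OF assms(4) char2 that])
    show "bij (poly f)" "poly f 0 = 0"
      using assms(4) by (simp_all add: o_polynomial_def permutation_polynomial_def)
    show "poly f x + x \<noteq> v" for x
      using assms(5) by auto
  qed (fact char2 assms)+
  show ?thesis
    using nkd_C NMDS_C weight_enumerator_C by blast
qed

end
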